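(* There exist $d\ge1$ and an IFS $\mathcal{F}$ on the Euclidean space $\mathbb{R}^d$ such that the attractor $K$ of $\mathcal{F}$, equipped with its natural fractal structure $\mathbf{\Gamma}$ as a self-similar set, satisfies $\dim_B(K)\neq\dim^2_{\mathbf{\Gamma}}(K)$ (both limits defining these dimensions existing).
   Context: IFS. An IFS on a metric space is a finite family $\mathcal{F}=\{f_i\}_{i\in I}$, $I=\{1,\dots,k\}$, of contractions (Lipschitz self-maps with constant $c_i<1$). Its attractor is the unique nonempty compact set $K$ with $K=\bigcup_{i\in I}f_i(K)$. Natural fractal structure. The natural fractal structure on $K$ as a self-similar set is the sequence $\mathbf{\Gamma}=\{\Gamma_n\}_{n\in\mathbb{N}}$ of coverings $\Gamma_n=\{f_\omega(K):\omega\in I^n\}$ of $K$, where $f_\omega=f_{\omega_1}\circ\cdots\circ f_{\omega_n}$; each $\Gamma_n$ is regarded as a family indexed by $I^n$, so the same set may appear several times and elements are counted with multiplicity. Dimensions. $\dim_B(F)=\lim_{\delta\to0}\frac{\log N_\delta(F)}{-\log\delta}$ is the box dimension of $F\subseteq\mathbb{R}^d$, where $N_\delta(F)$ is the number of cubes $[k_1\delta,(k_1+1)\delta]\times\cdots\times[k_d\delta,(k_d+1)\delta]$, $k_i\in\mathbb{Z}$, meeting $F$. The fractal dimension II of $F\subseteq K$ is $\dim^2_{\mathbf{\Gamma}}(F)=\lim_{n\to\infty}\frac{\log N_n(F)}{-\log\delta(F,\Gamma_n)}$, where $N_n(F)$ is the number of elements of $\Gamma_n$ meeting $F$ and $\delta(F,\Gamma_n)=\sup\{\operatorname{diam}(A):A\in\Gamma_n,\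 A\cap F\neq\emptyset\}$ (Euclidean diameter). *)

theory Defs
  imports "HOL-Analysis.Analysis"
begin

text \<open>Since the dimension is quantified inside the statement, the Euclidean space of dimension
  \<open>d\<close> is carried by the library's \<^const>\<open>Euclidean_space\<close>: the functions
  \<open>nat \<Rightarrow> real\<close> vanishing at every index \<open>\<ge> d\<close>.\<close>

definition Rn :: "nat \<Rightarrow> (nat \<Rightarrow> real) metric" where
  "Rn d = metric (topspace (Euclidean_space d), \<lambda>x y. L2_set (\<lambda>i. x i - y i) {..<d})"

lemma Metric_space_Rn:
  "Metric_space (topspace (Euclidean_space d)) (\<lambda>x y. L2_set (\<lambda>i. x i - y i) {..<d})"
proof
  fix x y z :: "nat \<Rightarrow> real"
  show "0 \<le> L2_set (\<lambda>i. x i - y i) {..<d}"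
    by simp
  show "L2_set (\<lambda>i. x i - y i) {..<d} = L2_set (\<lambda>i. y i - x i) {..<d}"
    by (simp add: L2_set_def power2_commute)
  show "L2_set (\<lambda>i. x i - y i) {..<d} = 0 \<longleftrightarrow> x = y"
    if "x \<in> topspace (Euclidean_space d)" "y \<in> topspace (Euclidean_space d)"
  proof -
    have "(\<forall>i<d. x i = y i) \<longleftrightarrow> x = y"
      using that by (auto simp: topspace_Euclidean_space fun_eq_iff) (metis not_le)
    then show ?thesis
      by (simp add: L2_set_eq_0_iff Ball_def)
  qed
  show "L2_set (\<lambda>i. x i - z i) {..<d}
      \<le> L2_set (\<lambda>i. x i - y i) {..<d} + L2_set (\<lambda>i. y i - z i) {..<d}"
    using L2_set_triangle_ineq[of "\<lambda>i. x i - y i" "\<lambda>i. y i - z i" "{..<d}"] by simp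
qed

lemma mspace_Rn [simp]: "mspace (Rn d) = {x. \<forall>i\<ge>d. x i = 0}"
  unfolding Rn_def Metric_space.mspace_metric[OF Metric_space_Rn] by (rule topspace_Euclidean_space)

lemma mdist_Rn [simp]: "mdist (Rn d) x y = L2_set (\<lambda>i. x i - y i) {..<d}"
  unfolding Rn_def Metric_space.mdist_metric[OF Metric_space_Rn] by (rule refl)


definition contraction_map :: "'a metric \<Rightarrow> ('a \<Rightarrow> 'a) \<Rightarrow> bool" where
  "contraction_map m f \<longleftrightarrow> f \<in> mspace m \<rightarrow> mspace m \<and>
     (\<exists>c. 0 \<le> c \<and> c < 1 \<and>
       (\<forall>x\<in>mspace m. \<forall>y\<in>mspace m. mdist m (f x) (f y) \<le> c * mdist m x y))"

definition IFS :: "'a metric \<Rightarrow> nat \<Rightarrow> (nat \<Rightarrow> 'a \<Rightarrow> 'a) \<Rightarrow> bool" where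
  "IFS m k f \<longleftrightarrow> 1 \<le> k \<and> (\<forall>i\<in>{1..k}. contraction_map m (f i))"

definition self_similar :: "'a metric \<Rightarrow> nat \<Rightarrow> (nat \<Rightarrow> 'a \<Rightarrow> 'a) \<Rightarrow> 'a set \<Rightarrow> bool" where
  "self_similar m k f K \<longleftrightarrow>
     K \<noteq> {} \<and> compactin (mtopology_of m) K \<and> K = (\<Union>i\<in>{1..k}. f i ` K)"

definition is_attractor :: "'a metric \<Rightarrow> nat \<Rightarrow> (nat \<Rightarrow> 'a \<Rightarrow> 'a) \<Rightarrow> 'a set \<Rightarrow> bool" where
  "is_attractor m k f K \<longleftrightarrow> self_similar m k f K \<and> (\<forall>L. self_similar m k f L \<longrightarrow> L = K)"


definition words :: "nat \<Rightarrow> nat \<Rightarrow> nat list set" where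
  "words k n = {w. length w = n \<and> set w \<subseteq> {1..k}}"

definition word_map :: "(nat \<Rightarrow> 'a \<Rightarrow> 'a) \<Rightarrow> nat list \<Rightarrow> 'a \<Rightarrow> 'a" where
  "word_map f w = foldr (\<lambda>i g. f i \<circ> g) w id"

text \<open>A sequence of indexed coverings is given by its index sets \<open>J n\<close> and its members
  \<open>A n w\<close> for \<open>w \<in> J n\<close>. Counting indices rather than sets is what counts members with
  multiplicity. The natural fractal structure has \<open>J = words k\<close> and \<open>A = natural_fs f K\<close>.\<close>

definition natural_fs :: "(nat \<Rightarrow> 'a \<Rightarrow> 'a) \<Rightarrow> 'a set \<Rightarrow> nat \<Rightarrow> nat list \<Rightarrow> 'a set" where
  "natural_fs f K n w = word_map f w ` K"

definition fs_count :: "(nat \<Rightarrow> 'i set) \<Rightarrow> (nat \<Rightarrow> 'i \<Rightarrow> 'a set) \<Rightarrow> 'a set \<Rightarrow> nat \<Rightarrow> nat" where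
  "fs_count J A F n = card {w \<in> J n. A n w \<inter> F \<noteq> {}}"

definition mdiam :: "'a metric \<Rightarrow> 'a set \<Rightarrow> real" where
  "mdiam m S = (if S = {} then 0 else SUP (x, y)\<in>S \<times> S. mdist m x y)"

definition fs_delta ::
  "'a metric \<Rightarrow> (nat \<Rightarrow> 'i set) \<Rightarrow> (nat \<Rightarrow> 'i \<Rightarrow> 'a set) \<Rightarrow> 'a set \<Rightarrow> nat \<Rightarrow> real" where
  "fs_delta m J A F n = (SUP w\<in>{w \<in> J n. A n w \<inter> F \<noteq> {}}. mdiam m (A n w))"

text \<open>If \<open>fs_delta\<close> vanishes, the conventions \<open>ln 0 = 0\<close> and \<open>x / 0 = 0\<close> make the quotient
  \<open>0\<close>, in agreement with reading \<open>- log 0\<close> as infinity.\<close>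

definition has_fractal_dim_II ::
  "'a metric \<Rightarrow> (nat \<Rightarrow> 'i set) \<Rightarrow> (nat \<Rightarrow> 'i \<Rightarrow> 'a set) \<Rightarrow> 'a set \<Rightarrow> real \<Rightarrow> bool" where
  "has_fractal_dim_II m J A F s \<longleftrightarrow>
     (\<lambda>n. ln (real (fs_count J A F n)) / (- ln (fs_delta m J A F n))) \<longlonglongrightarrow> s"


definition grid_cube :: "nat \<Rightarrow> real \<Rightarrow> (nat \<Rightarrow> int) \<Rightarrow> (nat \<Rightarrow> real) set" where
  "grid_cube d \<delta> z =
     {x \<in> mspace (Rn d). \<forall>i<d. of_int (z i) * \<delta> \<le> x i \<and> x i \<le> (of_int (z i) + 1) * \<delta>}"

text \<open>Cubes are counted as sets because \<open>grid_cube d \<delta> z\<close> ignores \<open>z i\<close> for \<open>i \<ge> d\<close>.\<close>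

definition box_count :: "nat \<Rightarrow> (nat \<Rightarrow> real) set \<Rightarrow> real \<Rightarrow> nat" where
  "box_count d F \<delta> = card {Q \<in> range (grid_cube d \<delta>). Q \<inter> F \<noteq> {}}"

definition has_box_dim :: "nat \<Rightarrow> (nat \<Rightarrow> real) set \<Rightarrow> real \<Rightarrow> bool" where
  "has_box_dim d F s \<longleftrightarrow>
     ((\<lambda>\<delta>. ln (real (box_count d F \<delta>)) / (- ln \<delta>)) \<longlongrightarrow> s) (at_right 0)"

end

theory Submission
  imports Defs "HOL-Real_Asymp.Real_Asymp"
begin

text \<open>The box dimension depends only on the set \<open>K\<close>, while the fractal dimension II also sees
  overlaps. The three maps \<open>x/2\<close>, \<open>x/2 + 1/4\<close>, \<open>x/2 + 1/2\<close> of the line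
  have attractor \<open>[0,1]\<close>, of box dimension \<open>1\<close>. The level \<open>n\<close> of the natural
  fractal structure consists of \<open>3^n\<close> intervals of length \<open>2^-n\<close>, which gives
  \<open>ln 3 / ln 2\<close>.\<close>

section \<open>Uniqueness of attractors\<close>

text \<open>The largest of the finitely many ratios serves every map; \<open>1 \<le> k\<close> makes
  this maximum one of the ratios, so it is still below 1.\<close>

lemma IFS_common_ratio:
  assumes "IFS m k f"
  obtains c where "0 \<le> c" "c < 1"
    "\<And>i x y. \<lbrakk>i \<in> {1..k}; x \<in> mspace m; y \<in> mspace m\<rbrakk>
       \<Longrightarrow> mdist m (f i x) (f i y) \<le> c * mdist m x y"
proof -
  have "\<forall>i\<in>{1..k}. \<exists>c. 0 \<le> c \<and> c < 1 \<and>
      (\<forall>x\<in>mspace m. \<forall>y\<in>mspace m. mdist m (f i x) (f i y) \<le> c * mdist m x y)"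
    using assms by (auto simp: IFS_def contraction_map_def)
  then obtain c where c: "\<forall>i\<in>{1..k}. 0 \<le> c i \<and> c i < 1 \<and>
      (\<forall>x\<in>mspace m. \<forall>y\<in>mspace m. mdist m (f i x) (f i y) \<le> c i * mdist m x y)"
    by metis
  define C where "C = Max (c ` {1..k})"
  have k: "1 \<le> k" using assms by (simp add: IFS_def)
  have le: "c i \<le> C" if "i \<in> {1..k}" for i
    unfolding C_def using that by (intro Max_ge) auto
  have "C \<in> c ` {1..k}"
    unfolding C_def using k by (intro Max_in) auto
  then have C: "0 \<le> C" "C < 1" using c by auto
  have "mdist m (f i x) (f i y) \<le> C * mdist m x y"
    if i: "i \<in> {1..k}" and "x \<in> mspace m" "y \<in> mspace m" for i x y
  proof -
    have "mdist m (f i x) (f i y) \<le> c i * mdist m x y" using c that by blast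
    also have "\<dots> \<le> C * mdist m x y"
      by (intro mult_right_mono le i) simp
    finally show ?thesis .
  qed
  with C that show thesis by blast
qed

text \<open>Write a point of \<open>K\<close> as the image of a point of \<open>K\<close> under a
  composition of \<open>n\<close> maps. The same composition sends any point of \<open>L\<close>
  into \<open>L\<close> and contracts distances by \<open>c ^ n\<close>, so points of
  \<open>L\<close> come arbitrarily close, and \<open>L\<close> is closed. Exchanging
  \<open>K\<close> and \<open>L\<close> gives uniqueness of the attractor.\<close>

lemma self_similar_subset:
  assumes IFS: "IFS m k f" and K: "self_similar m k f K" and L: "self_similar m k f L"
  shows "K \<subseteq> L"
proof
  interpret Metric_space "mspace m" "mdist m" by simp
  obtain c where c: "0 \<le> c" "c < 1"
    "\<And>i x y. \<lbrakk>i \<in> {1..k}; x \<in> mspace m; y \<in> mspace m\<rbrakk>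
       \<Longrightarrow> mdist m (f i x) (f i y) \<le> c * mdist m x y"
    using IFS_common_ratio[OF IFS] by metis
  have cK: "compactin mtopology K" and cL: "compactin mtopology L" and "L \<noteq> {}"
    using K L by (auto simp: self_similar_def mtopology_of_def)
  have subs: "K \<subseteq> mspace m" "L \<subseteq> mspace m"
    using cK cL compactin_subset_topspace by force+
  \<comment> \<open>Bounding the union also bounds distances between a point of \<open>K\<close> and
    a point of \<open>L\<close>, which starts the induction below.\<close>
  have "mbounded (K \<union> L)"
    using compactin_imp_mbounded[OF cK] compactin_imp_mbounded[OF cL] by (simp add: mbounded_Un)
  then obtain B where B: "\<And>x y. \<lbrakk>x \<in> K \<union> L; y \<in> K \<union> L\<rbrakk> \<Longrightarrow> mdist m x y \<le> B"
    unfolding mbounded_alt by blast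
  have approx: "\<exists>y\<in>L. mdist m x y \<le> c ^ n * B" if "x \<in> K" for n x
    using that
  proof (induction n arbitrary: x)
    case 0
    then show ?case using B \<open>L \<noteq> {}\<close> by auto
  next
    case (Suc n)
    then obtain i x' where i: "i \<in> {1..k}" and x': "x' \<in> K" "x = f i x'"
      using K unfolding self_similar_def by blast
    obtain y' where y': "y' \<in> L" "mdist m x' y' \<le> c ^ n * B" using Suc.IH[OF x'(1)] by blast
    have "f i y' \<in> L" using L i y'(1) unfolding self_similar_def by blast
    moreover have "mdist m x (f i y') \<le> c * mdist m x' y'"
      using c(3)[OF i] x' y'(1) subs by blast
    then have "mdist m x (f i y') \<le> c ^ Suc n * B"
      using mult_left_mono[OF y'(2) c(1)] by simp
    ultimately show ?case by blast
  qed
  fix x assume x: "x \<in> K"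
  have "(\<lambda>n. c ^ n * B) \<longlonglongrightarrow> 0"
    using c by (intro tendsto_mult_left_zero LIMSEQ_realpow_zero) auto
  then have small: "\<exists>n. c ^ n * B < r" if "r > 0" for r
    using order_tendstoD(2)[OF _ that] eventually_happens by fastforce
  have "\<exists>y\<in>L. y \<in> mball x r" if r: "r > 0" for r
  proof -
    obtain n where n: "c ^ n * B < r" using small[OF r] by blast
    obtain y where y: "y \<in> L" "mdist m x y \<le> c ^ n * B" using approx[OF x] by blast
    have "y \<in> mball x r"
      unfolding in_mball using x y n subs by (auto intro: le_less_trans)
    with y(1) show ?thesis by blast
  qed
  then have "x \<in> mtopology closure_of L"
    using x subs by (auto simp: metric_closure_of)
  then show "x \<in> L"
    using closure_of_closedin[OF compactin_imp_closedin[OF Hausdorff_space_mtopology cL]] by simp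
qed

lemma is_attractorI:
  assumes "IFS m k f" "self_similar m k f K"
  shows "is_attractor m k f K"
  using assms self_similar_subset[OF assms(1)] unfolding is_attractor_def by blast

section \<open>The natural fractal structure\<close>

lemma word_map_Nil_image [simp]: "word_map f [] ` A = A"
  by (simp add: word_map_def)

lemma word_map_Cons_image [simp]: "word_map f (i # w) ` A = f i ` word_map f w ` A"
  by (simp add: word_map_def image_comp)

lemma card_words: "card (words k n) = k ^ n"
  using card_lists_length_eq[of "{1..k}" n] by (simp add: words_def conj_commute)

text \<open>Each \<open>f i\<close> maps \<open>K\<close> into itself, hence so does every word map,
  and a piece is a nonempty subset of \<open>K\<close>. Thus no word is lost in the count.\<close>

lemma natural_fs_meets:
  assumes "self_similar m k f K" "w \<in> words k n"
  shows "natural_fs f K n w \<inter> K \<noteq> {}"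
proof -
  have "word_map f w ` K \<subseteq> K" if "set w \<subseteq> {1..k}" for w
    using that
  proof (induction w)
    case (Cons i w)
    then have "f i ` K \<subseteq> K" using assms(1) unfolding self_similar_def by force
    moreover have "word_map f w ` K \<subseteq> K" using Cons by simp
    ultimately show ?case unfolding word_map_Cons_image by blast
  qed simp
  then show ?thesis
    using assms by (simp add: natural_fs_def words_def self_similar_def Int_absorb2)
qed

lemma natural_fs_index_set:
  assumes "self_similar m k f K"
  shows "{w \<in> words k n. natural_fs f K n w \<inter> K \<noteq> {}} = words k n"
  using natural_fs_meets[OF assms] by blast

section \<open>Intervals in the one-dimensional Euclidean space\<close>

text \<open>The isometry of the real line onto \<open>Rn 1\<close>, along which intervals are
  transported.\<close>

definition point1 :: "real \<Rightarrow> nat \<Rightarrow> real" where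
  "point1 r = (\<lambda>i. if i = 0 then r else 0)"

lemma point1_0 [simp]: "point1 r 0 = r"
  by (simp add: point1_def)

lemma inj_point1: "inj point1"
  by (metis injI point1_0)

lemma mspace_Rn_1: "mspace (Rn 1) = range point1"
proof (intro equalityI subsetI)
  fix x assume "x \<in> mspace (Rn 1)"
  then have "x = point1 (x 0)" by (auto simp: point1_def fun_eq_iff)
  then show "x \<in> range point1" by blast
qed (auto simp: point1_def)

lemma mdist_point1 [simp]: "mdist (Rn 1) (point1 r) (point1 s) = \<bar>r - s\<bar>"
  by (simp add: L2_set_def)

declare mspace_Rn [simp del] mdist_Rn [simp del] One_nat_def [simp del]

lemma compactin_point1_image:
  assumes "compact S"
  shows "compactin (mtopology_of (Rn 1)) (point1 ` S)"
proof -
  have "Lipschitz_continuous_map euclidean_metric (Rn 1) point1"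
    unfolding Lipschitz_continuous_map_def
    by (intro conjI exI[of _ 1])
      (auto simp: mspace_Rn_1 dist_real_def)
  then have "continuous_map euclidean (mtopology_of (Rn 1)) point1"
    using Lipschitz_continuous_imp_continuous_map by fastforce
  then show ?thesis
    using assms image_compactin[of euclidean S] by (simp add: compactin_euclidean_iff)
qed

lemma mdiam_point1_interval:
  assumes "a \<le> b"
  shows "mdiam (Rn 1) (point1 ` {a..b}) = b - a"
proof -
  have "(SUP (x, y)\<in>point1 ` {a..b} \<times> point1 ` {a..b}. mdist (Rn 1) x y) = b - a"
  proof (rule cSup_eq_maximum)
    show "b - a \<in> (\<lambda>(x, y). mdist (Rn 1) x y) ` (point1 ` {a..b} \<times> point1 ` {a..b})"
      using assms
      by (intro image_eqI[of _ _ "(point1 b, point1 a)"]) (auto)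
  qed (auto)
  then show ?thesis using assms by (simp add: mdiam_def)
qed

lemma grid_cube_1: "grid_cube 1 \<delta> z = point1 ` {of_int (z 0) * \<delta>..(of_int (z 0) + 1) * \<delta>}"
  unfolding grid_cube_def mspace_Rn_1 by auto

text \<open>Cubes are closed, so the cube with index -1 counts because it touches 0. The indices
  that count therefore run from -1 to \<open>\<lfloor>1 / \<delta>\<rfloor>\<close>, and distinct
  indices give distinct cubes.\<close>

lemma box_count_unit_interval:
  assumes "0 < \<delta>"
  shows "real (box_count 1 (point1 ` {0..1}) \<delta>) = of_int \<lfloor>1 / \<delta>\<rfloor> + 2"
proof -
  define Q where "Q j = point1 ` {of_int j * \<delta>..(of_int j + 1) * \<delta>}" for j :: int
  have meets: "Q j \<inter> point1 ` {0..1} \<noteq> {} \<longleftrightarrow> j \<in> {-1..\<lfloor>1 / \<delta>\<rfloor>}" for j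
  proof -
    have "Q j \<inter> point1 ` {0..1} \<noteq> {} \<longleftrightarrow>
        {of_int j * \<delta>..(of_int j + 1) * \<delta>} \<inter> {0..1} \<noteq> {}"
      unfolding Q_def image_Int[OF inj_point1, symmetric] by simp
    also have "\<dots> \<longleftrightarrow> 0 \<le> (of_int j + 1) * \<delta> \<and> of_int j * \<delta> \<le> 1"
      using assms by (auto simp: Int_atLeastAtMost max_def min_def algebra_simps)
    also have "\<dots> \<longleftrightarrow> (0::real) \<le> of_int (j + 1) \<and> of_int j \<le> 1 / \<delta>"
      using assms by (simp add: zero_le_mult_iff pos_le_divide_eq)
    also have "\<dots> \<longleftrightarrow> j \<in> {-1..\<lfloor>1 / \<delta>\<rfloor>}"
      unfolding le_floor_iff[symmetric] of_int_0_le_iff by auto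
    finally show ?thesis .
  qed
  have "range (grid_cube 1 \<delta>) = range Q"
  proof -
    have "grid_cube 1 \<delta> = Q \<circ> (\<lambda>z. z 0)"
      by (simp add: grid_cube_1 Q_def fun_eq_iff)
    moreover have "range (\<lambda>z::nat \<Rightarrow> int. z 0) = UNIV"
      by (rule surjI[of _ "\<lambda>j _. j"]) simp
    ultimately show ?thesis by (metis image_comp)
  qed
  moreover have "{A \<in> range Q. A \<inter> point1 ` {0..1} \<noteq> {}} = Q ` {j. Q j \<inter> point1 ` {0..1} \<noteq> {}}"
    by blast
  ultimately have "{A \<in> range (grid_cube 1 \<delta>). A \<inter> point1 ` {0..1} \<noteq> {}} = Q ` {-1..\<lfloor>1 / \<delta>\<rfloor>}"
    by (simp only: meets Collect_mem_eq)
  moreover have "inj Q"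
  proof (rule injI)
    fix i j assume "Q i = Q j"
    then have "{of_int i * \<delta>..(of_int i + 1) * \<delta>} = {of_int j * \<delta>..(of_int j + 1) * \<delta>}"
      unfolding Q_def by (simp add: inj_image_eq_iff[OF inj_point1])
    then show "i = j" using assms by (auto simp: Icc_eq_Icc algebra_simps)
  qed
  ultimately have "box_count 1 (point1 ` {0..1}) \<delta> = nat (\<lfloor>1 / \<delta>\<rfloor> + 2)"
    unfolding box_count_def by (simp add: card_image inj_on_subset)
  then show ?thesis using assms by simp
qed

lemma has_box_dim_unit_interval: "has_box_dim 1 (point1 ` {0..1}) 1"
proof -
  \<comment> \<open>The count lies between \<open>1 / \<delta> + 1\<close> and
    \<open>1 / \<delta> + 2\<close>, so its logarithm is asymptotic to
    \<open>- ln \<delta>\<close>.\<close>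
  have "((\<lambda>\<delta>. ln (of_int \<lfloor>1 / \<delta>\<rfloor> + 2 :: real) / - ln \<delta>) \<longlongrightarrow> 1) (at_right 0)"
    by real_asymp
  then show ?thesis
    unfolding has_box_dim_def
    by (rule Lim_transform_eventually)
      (simp add: box_count_unit_interval eventually_mono[OF eventually_at_right_less])
qed

section \<open>An overlapping iterated function system\<close>

text \<open>For indices 1, 2, 3 the shifts are 0, 1/4, 1/2. The middle image of the unit interval
  overlaps both others, which adds pieces without enlarging the union.\<close>

definition overlap_map :: "nat \<Rightarrow> (nat \<Rightarrow> real) \<Rightarrow> nat \<Rightarrow> real" where
  "overlap_map i x = point1 (x 0 / 2 + (real i - 1) / 4)"

lemma overlap_map_point1 [simp]:
  "overlap_map i (point1 r) = point1 (r / 2 + (real i - 1) / 4)"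
  by (simp add: overlap_map_def)

lemma IFS_overlap: "IFS (Rn 1) 3 overlap_map"
proof -
  have "contraction_map (Rn 1) (overlap_map i)" for i
    unfolding contraction_map_def mspace_Rn_1
    by (intro conjI exI[of _ "1/2"]) (auto simp: abs_if)
  then show ?thesis by (simp add: IFS_def)
qed

lemma overlap_map_image_interval:
  "overlap_map i ` point1 ` {a..b} =
     point1 ` {a / 2 + (real i - 1) / 4..b / 2 + (real i - 1) / 4}"
proof -
  have "(\<lambda>r::real. r / 2 + (real i - 1) / 4) ` {a..b} =
     {a / 2 + (real i - 1) / 4..b / 2 + (real i - 1) / 4}"
    using image_affinity_atLeastAtMost[of "1/2" "(real i - 1) / 4" a b] by auto
  then show ?thesis by (metis (no_types, lifting) ext image_image overlap_map_point1)
qed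

lemma self_similar_overlap: "self_similar (Rn 1) 3 overlap_map (point1 ` {0..1})"
proof -
  have "{1..3::nat} = {1, 2, 3}" by auto
  moreover have "{0..1::real} = {0..1/2} \<union> {1/4..3/4} \<union> {1/2..1}" by auto
  moreover have "(\<Union>i\<in>{1, 2, 3}. overlap_map i ` point1 ` {0..1}) =
      point1 ` ({0..1/2} \<union> {1/4..3/4} \<union> {1/2..1})"
    by (simp add: overlap_map_image_interval image_Un Un_assoc)
  ultimately have "point1 ` {0..1} = (\<Union>i\<in>{1..3}. overlap_map i ` point1 ` {0..1})"
    by metis
  then show ?thesis
    by (auto simp: self_similar_def compactin_point1_image)
qed

lemma mdiam_natural_fs_overlap:
  assumes "length w = n"
  shows "mdiam (Rn 1) (natural_fs overlap_map (point1 ` {0..1}) n w) = (1/2) ^ n"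
proof -
  \<comment> \<open>The left endpoint varies with the word but does not affect the diameter, so only
    its existence is carried through the induction.\<close>
  have "\<exists>a. word_map overlap_map w ` point1 ` {0..1} = point1 ` {a..a + (1/2) ^ length w}" for w
  proof (induction w)
    case (Cons i w)
    then obtain a where
      "word_map overlap_map w ` point1 ` {0..1} = point1 ` {a..a + (1/2) ^ length w}"
      by blast
    then show ?case
      by (intro exI[of _ "a / 2 + (real i - 1) / 4"])
        (simp add: overlap_map_image_interval add_divide_distrib ac_simps)
  qed (auto intro: exI[of _ 0])
  then obtain a where
    "word_map overlap_map w ` point1 ` {0..1} = point1 ` {a..a + (1/2) ^ n}"
    using assms by blast
  then show ?thesis by (simp add: natural_fs_def mdiam_point1_interval)
qed

text \<open>Multiplicity is decisive: words such as \<open>[1, 3]\<close> and \<open>[2, 1]\<close>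
  give the same interval. Level \<open>n\<close> has only \<open>2 ^ (n + 1) - 1\<close> distinct
  intervals, whose count would lead to dimension 1, whereas counting words gives
  \<open>3 ^ n\<close>.\<close>

lemma has_fractal_dim_II_overlap:
  "has_fractal_dim_II (Rn 1) (words 3) (natural_fs overlap_map (point1 ` {0..1}))
     (point1 ` {0..1}) (ln 3 / ln 2)"
proof -
  let ?K = "point1 ` {0..1}"
  let ?A = "natural_fs overlap_map ?K"
  note index = natural_fs_index_set[OF self_similar_overlap]
  have count: "fs_count (words 3) ?A ?K n = 3 ^ n" for n
    by (simp add: fs_count_def index card_words)
  have delta: "fs_delta (Rn 1) (words 3) ?A ?K n = (1/2) ^ n" for n
  proof -
    \<comment> \<open>A supremum of a constant equals that constant only over a nonempty index
      set.\<close>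
    have "replicate n 1 \<in> words 3 n" by (auto simp: words_def)
    then have "words 3 n \<noteq> {}" by blast
    moreover have "mdiam (Rn 1) (?A n w) = (1/2) ^ n" if "w \<in> words 3 n" for w
      using that by (intro mdiam_natural_fs_overlap) (simp add: words_def)
    ultimately show ?thesis
      unfolding fs_delta_def index by simp
  qed
  \<comment> \<open>At \<open>n = 0\<close> the diameter is 1 and the quotient is
    \<open>0 / 0 = 0\<close>; from then on it is constant.\<close>
  have "ln (real (fs_count (words 3) ?A ?K n)) / - ln (fs_delta (Rn 1) (words 3) ?A ?K n)
      = ln 3 / ln 2" if "n > 0" for n
    using that by (simp add: count delta ln_realpow ln_div)
  then show ?thesis
    unfolding has_fractal_dim_II_def
    by (intro tendsto_eventually eventually_mono[OF eventually_gt_at_top[of 0]])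
qed

theorem mainTheorem6:
  shows "\<exists>(d::nat) (k::nat) (f :: nat \<Rightarrow> (nat \<Rightarrow> real) \<Rightarrow> (nat \<Rightarrow> real)) K s t.
    1 \<le> d \<and> IFS (Rn d) k f \<and> is_attractor (Rn d) k f K \<and>
    has_box_dim d K s \<and>
    has_fractal_dim_II (Rn d) (words k) (natural_fs f K) K t \<and>
    s \<noteq> t"
proof -
  have "1 \<noteq> ln 3 / ln (2::real)" by simp
  with IFS_overlap is_attractorI[OF IFS_overlap self_similar_overlap]
    has_box_dim_unit_interval has_fractal_dim_II_overlap
  show ?thesis by (metis order_refl)
qed

end
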